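(* Let $X$ be a graph, let $u$ and $v$ be distinct vertices of $X$, and let $\beta,\gamma$ be real numbers. Then \[ \phi(X^{\beta,\gamma}_{u,v},t)=\phi(X,t)-2\beta\,\phi_{uv}-\gamma(\phi_v+\phi_u)+(\gamma^2-\beta^2)\,\phi(X\setminus\{u,v\},t). \] Further, if $u$ and $v$ are cospectral, then \[ \frac{\phi(X^{\beta,\gamma}_{u,v},t)}{\phi(X,t)}=\left(1-\frac{(\beta-\gamma)(\phi_{uv}-\phi_u)}{\phi(X,t)}\right)\left(1-\frac{(\beta+\gamma)(\phi_{uv}+\phi_u)}{\phi(X,t)}\right). \]
   Context: For a (weighted) graph $Y$, $\phi(Y,t)=\det(tI-A(Y))$ is the characteristic polynomial of its adjacency matrix, and $X\setminus S$ denotes the graph obtained by deleting the vertices in $S$. Write $\phi_u=\phi(X\setminus u,t)$ and $\phi_v=\phi(X\setminus v,t)$. The polynomial $\phi_{uv}=\phi_{u,v}(X,t)$ is defined by $\left((I-tA)^{-1}\right)_{u,v}=\dfrac{t^{-1}\phi_{u,v}(X,t^{-1})}{\phi(X,t^{-1})}$, where $A=A(X)$; equivalently $\phi_{u,v}(X,t)=\phi(X,t)\left((tI-A)^{-1}\right)_{u,v}$. Vertices $u,v$ are cospectral if $\phi(X\setminus u,t)=\phi(X\setminus v,t)$. $X^{\beta,\gamma}_{u,v}$ is the weighted graph with adjacency matrix $A+H$, where $H=\beta(e_ue_v^T+e_ve_u^T)+\gamma(e_ue_u^T+e_ve_v^T)$ and $e_w$ denotes the standard basis vector indexed by $w$.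 *)

theory Defs
  imports
    "HOL-Computational_Algebra.Polynomial_Factorial"
    "Jordan_Normal_Form.Char_Poly"
    "Jordan_Normal_Form.Gauss_Jordan_Elimination"
begin

(* Real-weighted undirected graphs, loops allowed: weight X x x is the weight of the loop at x,
   and weight 0 means that there is no edge.  Only the weights on pairs of vertices are
   relevant.  An unweighted graph is the case of weights 0 and 1, with 0 on the diagonal. *)
record 'a wgraph =
  verts :: "'a set"
  weight :: "'a \<Rightarrow> 'a \<Rightarrow> real"

definition weighted_graph :: "'a wgraph \<Rightarrow> bool" where
  "weighted_graph X \<longleftrightarrow>
     finite (verts X) \<and> (\<forall>x\<in>verts X. \<forall>y\<in>verts X. weight X x y = weight X y x)"

definition delete_verts :: "'a wgraph \<Rightarrow> 'a set \<Rightarrow> 'a wgraph" where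
  "delete_verts X S = X\<lparr>verts := verts X - S\<rparr>"

(* Matrices are indexed by 0..<n, so the vertices are numbered.  The choice of the numbering
   only conjugates adj_matrix by a permutation matrix, which affects neither the
   characteristic polynomial nor the entries of the resolvent addressed by vertices. *)
definition vertex_enum :: "'a wgraph \<Rightarrow> nat \<Rightarrow> 'a" where
  "vertex_enum X = (SOME e. bij_betw e {0..<card (verts X)} (verts X))"

definition vertex_index :: "'a wgraph \<Rightarrow> 'a \<Rightarrow> nat" where
  "vertex_index X = inv_into {0..<card (verts X)} (vertex_enum X)"

definition adj_matrix :: "'a wgraph \<Rightarrow> real mat" where
  "adj_matrix X = mat (card (verts X)) (card (verts X))
     (\<lambda>(i, j). weight X (vertex_enum X i) (vertex_enum X j))"

definition graph_char_poly :: "'a wgraph \<Rightarrow> real poly" where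
  "graph_char_poly X = char_poly (adj_matrix X)"

(* (t I - A)^(-1) over the field of rational functions in t *)
definition resolvent :: "'a wgraph \<Rightarrow> real poly fract mat" where
  "resolvent X = the (mat_inverse (map_mat to_fract (char_poly_matrix (adj_matrix X))))"

definition cross_poly :: "'a wgraph \<Rightarrow> 'a \<Rightarrow> 'a \<Rightarrow> real poly" where
  "cross_poly X u v = (THE p. to_fract p =
     to_fract (graph_char_poly X) * resolvent X $$ (vertex_index X u, vertex_index X v))"

definition cospectral_verts :: "'a wgraph \<Rightarrow> 'a \<Rightarrow> 'a \<Rightarrow> bool" where
  "cospectral_verts X u v \<longleftrightarrow>
     graph_char_poly (delete_verts X {u}) = graph_char_poly (delete_verts X {v})"

(* The sum of outer products beta (e_u e_v^T + e_v e_u^T) + gamma (e_u e_u^T + e_v e_v^T)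
   is added to the adjacency matrix. *)
definition perturb :: "'a wgraph \<Rightarrow> 'a \<Rightarrow> 'a \<Rightarrow> real \<Rightarrow> real \<Rightarrow> 'a wgraph" where
  "perturb X u v \<beta> \<gamma> = X\<lparr>weight := \<lambda>x y. weight X x y
     + \<beta> * (of_bool (x = u \<and> y = v) + of_bool (x = v \<and> y = u))
     + \<gamma> * (of_bool (x = u \<and> y = u) + of_bool (x = v \<and> y = v))\<rparr>"

lemma weighted_graph_perturb:
  assumes "weighted_graph X"
  shows "weighted_graph (perturb X u v \<beta> \<gamma>)"
proof -
  have "weight (perturb X u v \<beta> \<gamma>) x y = weight (perturb X u v \<beta> \<gamma>) y x"
    if "weight X x y = weight X y x" for x y
    unfolding perturb_def using that by (simp add: conj_commute add.commute)
  moreover have "verts (perturb X u v \<beta> \<gamma>) = verts X"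
    unfolding perturb_def by simp
  ultimately show ?thesis
    using assms unfolding weighted_graph_def by metis
qed

lemma weighted_graph_delete_verts: "weighted_graph X \<Longrightarrow> weighted_graph (delete_verts X S)"
  unfolding weighted_graph_def delete_verts_def by auto

lemma vertex_enum_bij:
  assumes "weighted_graph X"
  shows "bij_betw (vertex_enum X) {0..<card (verts X)} (verts X)"
proof -
  have "finite (verts X)" using assms unfolding weighted_graph_def by simp
  from someI_ex[OF ex_bij_betw_nat_finite[OF this]] show ?thesis
    unfolding vertex_enum_def .
qed

lemma vertex_index_less:
  assumes "weighted_graph X" "u \<in> verts X"
  shows "vertex_index X u < card (verts X)"
  using inv_into_into[of u "vertex_enum X" "{0..<card (verts X)}"] vertex_enum_bij[OF assms(1)] assms(2)
  unfolding vertex_index_def bij_betw_def by auto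

lemma adj_matrix_carrier: "adj_matrix X \<in> carrier_mat (card (verts X)) (card (verts X))"
  unfolding adj_matrix_def by simp

interpretation to_fract_hom: comm_ring_hom "to_fract :: real poly \<Rightarrow> real poly fract"
  by unfold_locales auto

lemma graph_char_poly_nonzero: "graph_char_poly X \<noteq> 0"
  using degree_monic_char_poly[OF adj_matrix_carrier[of X]] unfolding graph_char_poly_def by auto

lemma resolvent_inverse:
  fixes X :: "'a wgraph"
  defines "n \<equiv> card (verts X)"
    and "M \<equiv> map_mat to_fract (char_poly_matrix (adj_matrix X))"
  shows "resolvent X \<in> carrier_mat n n" "M * resolvent X = 1\<^sub>m n" "resolvent X * M = 1\<^sub>m n"
proof -
  have M: "M \<in> carrier_mat n n"
    unfolding M_def n_def using char_poly_matrix_closed[OF adj_matrix_carrier] by simp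
  have "det M = to_fract (graph_char_poly X)"
    unfolding M_def graph_char_poly_def char_poly_def by simp
  hence "det M \<noteq> 0" using graph_char_poly_nonzero by simp
  from det_non_zero_imp_unit[OF M this, of b]
  have "M \<in> Units (ring_mat TYPE(real poly fract) n b)" .
  with mat_inverse(1)[OF M, of b] obtain B where B: "mat_inverse M = Some B" by auto
  hence "resolvent X = B" unfolding resolvent_def M_def by simp
  with mat_inverse(2)[OF M B]
  show "resolvent X \<in> carrier_mat n n" "M * resolvent X = 1\<^sub>m n" "resolvent X * M = 1\<^sub>m n"
    by auto
qed

lemma cross_poly_adjugate:
  assumes "weighted_graph X" "u \<in> verts X" "v \<in> verts X"
  shows "to_fract (adj_mat (char_poly_matrix (adj_matrix X)) $$ (vertex_index X u, vertex_index X v))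
    = to_fract (graph_char_poly X) * resolvent X $$ (vertex_index X u, vertex_index X v)"
proof -
  let ?n = "card (verts X)"
  let ?C = "char_poly_matrix (adj_matrix X)"
  let ?M = "map_mat to_fract ?C"
  let ?f = "to_fract (graph_char_poly X)"
  have C: "?C \<in> carrier_mat ?n ?n"
    using char_poly_matrix_closed[OF adj_matrix_carrier] .
  note R = resolvent_inverse[of X]
  note a = adj_mat[OF C]
  have aM: "map_mat to_fract (adj_mat ?C) \<in> carrier_mat ?n ?n" using a by simp
  have M: "?M \<in> carrier_mat ?n ?n" using C by simp
  have "?M * map_mat to_fract (adj_mat ?C) = map_mat to_fract (?C * adj_mat ?C)"
    using to_fract_hom.mat_hom_mult[OF C a(1)] by simp
  also have "\<dots> = ?f \<cdot>\<^sub>m 1\<^sub>m ?n"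
    unfolding a graph_char_poly_def char_poly_def
    by (rule eq_matI) auto
  finally have 1: "?M * map_mat to_fract (adj_mat ?C) = ?f \<cdot>\<^sub>m 1\<^sub>m ?n" .
  have "map_mat to_fract (adj_mat ?C) = (resolvent X * ?M) * map_mat to_fract (adj_mat ?C)"
    unfolding R using aM by simp
  also have "\<dots> = resolvent X * (?f \<cdot>\<^sub>m 1\<^sub>m ?n)"
    using assoc_mult_mat[OF R(1) M aM] 1 by simp
  also have "\<dots> = ?f \<cdot>\<^sub>m resolvent X"
    using mult_smult_distrib[OF R(1), of "1\<^sub>m ?n" ?n ?f] right_mult_one_mat[OF R(1)] by simp
  finally have "map_mat to_fract (adj_mat ?C) = ?f \<cdot>\<^sub>m resolvent X" .
  from arg_cong[OF this, of "\<lambda>N. N $$ (vertex_index X u, vertex_index X v)"]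
  show ?thesis
    using vertex_index_less[OF assms(1,2)] vertex_index_less[OF assms(1,3)] a(1) R(1) by simp
qed

lemma cross_poly_ex1:
  assumes "weighted_graph X" "u \<in> verts X" "v \<in> verts X"
  shows "\<exists>!p. to_fract p =
    to_fract (graph_char_poly X) * resolvent X $$ (vertex_index X u, vertex_index X v)"
  unfolding cross_poly_adjugate[OF assms, symmetric] by auto

lemma cross_poly_eq_adjugate:
  assumes "weighted_graph X" "u \<in> verts X" "v \<in> verts X"
  shows "cross_poly X u v = adj_mat (char_poly_matrix (adj_matrix X)) $$ (vertex_index X u, vertex_index X v)"
  unfolding cross_poly_def
  by (rule the1_equality[OF cross_poly_ex1[OF assms]]) (rule cross_poly_adjugate[OF assms])

(* The generating-function form of the definition of cross_poly. *)
lemma cross_poly_generating_function: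
  assumes "weighted_graph X" "u \<in> verts X" "v \<in> verts X"
    and t: "t \<noteq> 0" "poly (graph_char_poly X) (inverse t) \<noteq> 0"
    and B: "B \<in> carrier_mat (card (verts X)) (card (verts X))"
      "B * (1\<^sub>m (card (verts X)) - t \<cdot>\<^sub>m adj_matrix X) = 1\<^sub>m (card (verts X))"
  shows "B $$ (vertex_index X u, vertex_index X v) =
    inverse t * poly (cross_poly X u v) (inverse t) / poly (graph_char_poly X) (inverse t)"
proof -
  let ?n = "card (verts X)"
  let ?A = "adj_matrix X"
  let ?C = "char_poly_matrix ?A"
  let ?s = "inverse t"
  let ?p = "\<lambda>q. poly q ?s"
  let ?f = "?p (graph_char_poly X)"
  have A: "?A \<in> carrier_mat ?n ?n" by (rule adj_matrix_carrier)
  have C: "?C \<in> carrier_mat ?n ?n" using char_poly_matrix_closed[OF A] .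
  note a = adj_mat[OF C]
  let ?N = "map_mat ?p (adj_mat ?C)"
  have N: "?N \<in> carrier_mat ?n ?n" using a by simp
  have L: "1\<^sub>m ?n - t \<cdot>\<^sub>m ?A \<in> carrier_mat ?n ?n"
    by (intro minus_carrier_mat smult_carrier_mat A)
  have "map_mat ?p ?C = ?s \<cdot>\<^sub>m (1\<^sub>m ?n - t \<cdot>\<^sub>m ?A)"
    by (rule eq_matI) (use A t in \<open>auto simp: char_poly_matrix_def field_simps\<close>)
  moreover have "map_mat ?p ?C * ?N = map_mat ?p (?C * adj_mat ?C)"
    using semiring_hom.mat_hom_mult[OF poly_hom.semiring_hom_axioms C a(1)] by simp
  moreover have "map_mat ?p (?C * adj_mat ?C) = ?f \<cdot>\<^sub>m 1\<^sub>m ?n"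
    unfolding a graph_char_poly_def char_poly_def by (rule eq_matI) auto
  ultimately have "?s \<cdot>\<^sub>m ((1\<^sub>m ?n - t \<cdot>\<^sub>m ?A) * ?N) = ?f \<cdot>\<^sub>m 1\<^sub>m ?n"
    using mult_smult_assoc_mat[OF L N] by simp
  hence "B * (?s \<cdot>\<^sub>m ((1\<^sub>m ?n - t \<cdot>\<^sub>m ?A) * ?N)) = B * (?f \<cdot>\<^sub>m 1\<^sub>m ?n)" by simp
  moreover have "B * (?s \<cdot>\<^sub>m ((1\<^sub>m ?n - t \<cdot>\<^sub>m ?A) * ?N)) = ?s \<cdot>\<^sub>m ?N"
    using mult_smult_distrib[OF B(1) mult_carrier_mat[OF L N]] assoc_mult_mat[OF B(1) L N] B(2) N
    by simp
  moreover have "B * (?f \<cdot>\<^sub>m 1\<^sub>m ?n) = ?f \<cdot>\<^sub>m B"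
    using mult_smult_distrib[OF B(1), of "1\<^sub>m ?n" ?n ?f] right_mult_one_mat[OF B(1)] by simp
  ultimately have "?s \<cdot>\<^sub>m ?N = ?f \<cdot>\<^sub>m B" by simp
  from arg_cong[OF this, of "\<lambda>N. N $$ (vertex_index X u, vertex_index X v)"]
  have "?s * ?p (cross_poly X u v) = ?f * B $$ (vertex_index X u, vertex_index X v)"
    unfolding cross_poly_eq_adjugate[OF assms(1-3)]
    using vertex_index_less[OF assms(1,2)] vertex_index_less[OF assms(1,3)] a(1) B(1) by simp
  thus ?thesis using t by (simp add: field_simps)
qed

end

theory Submission
  imports Defs
begin

text \<open>
  Adding \<open>H\<close> to the adjacency matrix changes only the rows \<open>u\<close> and \<open>v\<close> of \<open>tI - A\<close>, and only by
  combinations of the unit rows at \<open>u\<close> and \<open>v\<close>. The determinant is linear in each of these two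
  rows, so it expands into four parts: the old determinant; two parts in which one row is
  replaced, which are combinations of cofactors of \<open>tI - A\<close>; and one part in which both rows are
  replaced, which is the \<open>2 \<times> 2\<close> determinant \<open>\<gamma>\<^sup>2 - \<beta>\<^sup>2\<close> of \<open>-H\<close> on \<open>{u, v}\<close> times the complementary
  principal minor (\<open>det_on_perturb_two_rows\<close>). Diagonal cofactors and the complementary minor are
  characteristic polynomials of vertex-deleted graphs. The two off-diagonal cofactors are
  \<open>\<phi>\<^sub>u\<^sub>v\<close>, because the resolvent is the adjugate divided by the determinant, and they agree because
  the matrix is symmetric.

  The factorization for cospectral vertices rests on Jacobi's identity for the complementary
  minor, \<open>\<phi>(X) \<phi>(X - {u, v}) = \<phi>\<^sub>u \<phi>\<^sub>v - \<phi>\<^sub>u\<^sub>v\<^sup>2\<close> (\<open>jacobi_complementary_minor\<close>). With \<open>\<phi>\<^sub>u = \<phi>\<^sub>v\<close> the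
  right-hand side is a difference of two squares, and \<open>\<phi>(X)\<close> times the expansion then splits into
  two factors.

  Deleting a vertex renumbers the remaining ones. To avoid tracking the renumbering, determinants
  are taken over the vertex set itself, by Leibniz's formula; they agree with the determinant of
  the matrix for every enumeration (\<open>det_on_eq_det_mat\<close>).
\<close>

section \<open>Determinants over a finite index set\<close>

definition det_on :: "'a set \<Rightarrow> ('a \<Rightarrow> 'a \<Rightarrow> 'r) \<Rightarrow> 'r :: comm_ring_1" where
  "det_on V f = (\<Sum>p | p permutes V. of_int (sign p) * (\<Prod>x\<in>V. f x (p x)))"

definition unit_row :: "'a \<Rightarrow> 'a \<Rightarrow> 'r :: comm_ring_1" where
  "unit_row k y = of_bool (y = k)"

text \<open>
  The sign and the deleted row and column of the usual cofactor are replaced by a unit row,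
  which keeps the index set unchanged and makes the row expansion below free of signs.
\<close>

definition cofactor_on :: "'a set \<Rightarrow> ('a \<Rightarrow> 'a \<Rightarrow> 'r) \<Rightarrow> 'a \<Rightarrow> 'a \<Rightarrow> 'r :: comm_ring_1" where
  "cofactor_on V f x k = det_on V (f(x := unit_row k))"

lemma det_on_cong:
  assumes "\<And>x y. x \<in> V \<Longrightarrow> y \<in> V \<Longrightarrow> f x y = g x y"
  shows "det_on V f = det_on V g"
  unfolding det_on_def
  by (intro sum.cong prod.cong refl arg_cong2[of _ _ _ _ "(*)"] assms)
    (auto simp: permutes_in_image)

lemma det_on_empty [simp]: "det_on {} f = 1"
  unfolding det_on_def by (simp add: sign_id)

lemma det_on_reindex:
  assumes e: "bij_betw e I V" and "finite I"
  shows "det_on V f = det_on I (\<lambda>i j. f (e i) (e j))"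
proof -
  let ?m = "map_permutation I e"
  have inj: "inj_on e I" and im: "e ` I = V" using e by (auto simp: bij_betw_def)
  have e': "bij_betw (inv_into I e) V I" by (rule bij_betw_inv_into[OF e])
  have bij: "bij_betw ?m {p. p permutes I} {p. p permutes V}"
  proof (rule bij_betw_byWitness[where f' = "map_permutation V (inv_into I e)"])
    show "\<forall>p\<in>{p. p permutes I}. map_permutation V (inv_into I e) (?m p) = p"
      using map_permutation_compose_inv[OF e] inv_into_f_f[OF inj] by auto
    show "\<forall>p\<in>{p. p permutes V}. ?m (map_permutation V (inv_into I e) p) = p"
      using map_permutation_compose_inv[OF e'] bij_betw_inv_into_right[OF e] by auto
  qed (use map_permutation_permutes[OF e] map_permutation_permutes[OF e'] in auto)
  have "det_on V f = (\<Sum>p | p permutes I. of_int (sign (?m p)) * (\<Prod>x\<in>V. f x (?m p x)))"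
    unfolding det_on_def by (rule sum.reindex_bij_betw[OF bij, symmetric])
  also have "\<dots> = det_on I (\<lambda>i j. f (e i) (e j))"
    unfolding det_on_def
  proof (rule sum.cong[OF refl])
    fix p assume "p \<in> {p. p permutes I}"
    hence p: "p permutes I" by simp
    have "sign (?m p) = sign p"
      by (rule sign_map_permutation) (use inj p \<open>finite I\<close> in auto)
    moreover have "(\<Prod>x\<in>V. f x (?m p x)) = (\<Prod>i\<in>I. f (e i) (e (p i)))"
      unfolding im[symmetric] prod.reindex[OF inj]
      by (rule prod.cong) (auto simp: map_permutation_apply[OF inj])
    ultimately show "of_int (sign (?m p)) * (\<Prod>x\<in>V. f x (?m p x))
        = of_int (sign p) * (\<Prod>i\<in>I. f (e i) (e (p i)))" by simp
  qed
  finally show ?thesis .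
qed

lemma det_mat_eq_det_on: "det (mat n n (\<lambda>(i, j). f i j)) = det_on {0..<n} f"
proof -
  have "(\<Prod>i\<in>{0..<n}. mat n n (\<lambda>(i, j). f i j) $$ (i, p i)) = (\<Prod>i\<in>{0..<n}. f i (p i))"
    if "p permutes {0..<n}" for p
    using permutes_in_image[OF that] by (intro prod.cong) auto
  thus ?thesis unfolding det_on_def det_def by simp
qed

lemma det_on_eq_det_mat:
  assumes "bij_betw e {0..<n} V"
  shows "det_on V f = det (mat n n (\<lambda>(i, j). f (e i) (e j)))"
  unfolding det_mat_eq_det_on det_on_reindex[OF assms finite_atLeastLessThan] ..

lemma det_on_transpose:
  assumes "finite V"
  shows "det_on V (\<lambda>x y. f y x) = det_on V f"
proof -
  obtain e where e: "bij_betw e {0..<card V} V" using ex_bij_betw_nat_finite[OF assms] by blast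
  let ?A = "mat (card V) (card V) (\<lambda>(i, j). f (e i) (e j))"
  have "mat (card V) (card V) (\<lambda>(i, j). f (e j) (e i)) = transpose_mat ?A"
    by (rule eq_matI) auto
  thus ?thesis unfolding det_on_eq_det_mat[OF e] using det_transpose[of ?A "card V"] by simp
qed

lemma det_on_mult:
  assumes "finite V"
  shows "det_on V (\<lambda>x y. \<Sum>k\<in>V. f x k * g k y) = det_on V f * det_on V g"
proof -
  obtain e where e: "bij_betw e {0..<card V} V" using ex_bij_betw_nat_finite[OF assms] by blast
  let ?mat = "\<lambda>f. mat (card V) (card V) (\<lambda>(i, j). f (e i) (e j))"
  have "?mat (\<lambda>x y. \<Sum>k\<in>V. f x k * g k y) = ?mat f * ?mat g"
    by (rule eq_matI) (auto simp: scalar_prod_def sum.reindex_bij_betw[OF e, symmetric])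
  thus ?thesis
    unfolding det_on_eq_det_mat[OF e] using det_mult[of "?mat f" "card V" "?mat g"] by simp
qed

lemma det_on_identical_rows:
  assumes "finite V" "u \<in> V" "v \<in> V" "u \<noteq> v" and eq: "\<And>y. y \<in> V \<Longrightarrow> f u y = f v y"
  shows "det_on V f = 0"
proof -
  obtain e where e: "bij_betw e {0..<card V} V" using ex_bij_betw_nat_finite[OF assms(1)] by blast
  have im: "e ` {0..<card V} = V" using e by (simp add: bij_betw_def)
  have ex: "\<exists>i<card V. x = e i" if "x \<in> V" for x
    using that bij_betw_imp_surj_on[OF e] by fastforce
  obtain i where i: "i < card V" "u = e i" using ex[OF assms(2)] by blast
  obtain j where j: "j < card V" "v = e j" using ex[OF assms(3)] by blast
  note ij = i(1) j(1) i(2) j(2)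
  have "e k \<in> V" if "k < card V" for k using im that by auto
  hence "row (mat (card V) (card V) (\<lambda>(i, j). f (e i) (e j))) i =
      row (mat (card V) (card V) (\<lambda>(i, j). f (e i) (e j))) j"
    using ij eq by (intro eq_vecI) auto
  thus ?thesis
    unfolding det_on_eq_det_mat[OF e] using ij assms(4)
    by (intro det_identical_rows[of _ "card V" i j]) auto
qed

lemma det_on_fun_upd:
  assumes "finite V" "u \<in> V"
  shows "det_on V (f(u := g)) =
    (\<Sum>p | p permutes V. of_int (sign p) * (g (p u) * (\<Prod>x\<in>V - {u}. f x (p x))))"
  unfolding det_on_def
  by (intro sum.cong refl arg_cong2[of _ _ _ _ "(*)"]) (auto simp: prod.remove[OF assms])

text \<open>
  In Leibniz's formula the row \<open>u\<close> contributes the single factor \<open>g (p u)\<close>; the unit rows sort the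
  permutations by the value \<open>p u\<close>.
\<close>

lemma det_on_expand_row:
  assumes "finite V" "u \<in> V"
  shows "det_on V (f(u := g)) = (\<Sum>k\<in>V. g k * cofactor_on V f u k)"
proof -
  let ?P = "{p. p permutes V}"
  let ?w = "\<lambda>p. of_int (sign p) * (\<Prod>x\<in>V - {u}. f x (p x))"
  have fin: "finite ?P" by (rule finite_permutations[OF assms(1)])
  have "(\<Sum>k\<in>V. g k * cofactor_on V f u k) = (\<Sum>k\<in>V. \<Sum>p\<in>?P. ?w p * (g k * unit_row k (p u)))"
    unfolding cofactor_on_def det_on_fun_upd[OF assms] by (simp add: sum_distrib_left mult_ac)
  also have "\<dots> = (\<Sum>p\<in>?P. ?w p * (\<Sum>k\<in>V. g k * unit_row k (p u)))"
    by (subst sum.swap) (simp add: sum_distrib_left)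
  also have "\<dots> = (\<Sum>p\<in>?P. ?w p * g (p u))"
  proof (rule sum.cong[OF refl])
    fix p assume "p \<in> ?P"
    hence "p u \<in> V" using assms(2) by (simp add: permutes_in_image)
    hence "(\<Sum>k\<in>V. g k * unit_row k (p u)) = g (p u)"
      using assms(1) by (simp add: unit_row_def of_bool_def if_distrib sum.delta cong: if_cong)
    thus "?w p * (\<Sum>k\<in>V. g k * unit_row k (p u)) = ?w p * g (p u)" by simp
  qed
  also have "\<dots> = det_on V (f(u := g))"
    unfolding det_on_fun_upd[OF assms] by (simp add: mult_ac)
  finally show ?thesis ..
qed

lemma det_on_add_row:
  assumes "finite V" "u \<in> V"
  shows "det_on V (f(u := \<lambda>y. g y + h y)) = det_on V (f(u := g)) + det_on V (f(u := h))"
  unfolding det_on_expand_row[OF assms] by (simp add: distrib_right sum.distrib)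

lemma det_on_expand_sparse_row:
  assumes "finite V" "u \<in> V" "v \<in> V" "u \<noteq> v" and "\<And>y. y \<in> V - {u, v} \<Longrightarrow> g y = 0" and "x \<in> V"
  shows "det_on V (f(x := g)) = g u * cofactor_on V f x u + g v * cofactor_on V f x v"
proof -
  have "det_on V (f(x := g)) = (\<Sum>k\<in>{u, v}. g k * cofactor_on V f x k)"
    unfolding det_on_expand_row[OF assms(1,6)]
    by (rule sum.mono_neutral_right) (use assms in auto)
  thus ?thesis using assms(4) by simp
qed

text \<open>Only the permutations that fix \<open>u\<close> contribute, and these are the permutations of \<open>V - {u}\<close>.\<close>

lemma cofactor_on_diag:
  assumes "finite V" "u \<in> V"
  shows "cofactor_on V f u u = det_on (V - {u}) f"
proof -
  let ?t = "\<lambda>p. of_int (sign p) * (unit_row u (p u) * (\<Prod>x\<in>V - {u}. f x (p x)))"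
  have "cofactor_on V f u u = (\<Sum>p | p permutes V. ?t p)"
    unfolding cofactor_on_def det_on_fun_upd[OF assms] ..
  also have "\<dots> = (\<Sum>p | p permutes (V - {u}). ?t p)"
  proof (rule sum.mono_neutral_right)
    show "finite {p. p permutes V}" by (rule finite_permutations[OF assms(1)])
    show "{p. p permutes (V - {u})} \<subseteq> {p. p permutes V}"
      by (auto intro: permutes_subset)
    show "\<forall>p\<in>{p. p permutes V} - {p. p permutes (V - {u})}. ?t p = 0"
    proof
      fix p assume p: "p \<in> {p. p permutes V} - {p. p permutes (V - {u})}"
      have "p u \<noteq> u"
        using p permutes_superset[of p V "V - {u}"] by auto
      thus "?t p = 0" by (simp add: unit_row_def)
    qed
  qed
  also have "\<dots> = det_on (V - {u}) f"
    unfolding det_on_def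
    by (rule sum.cong) (auto simp: unit_row_def permutes_not_in)
  finally show ?thesis .
qed

text \<open>
  A unit row at \<open>(u, v)\<close> makes the other entries of column \<open>v\<close> irrelevant, so the cofactor is also
  the determinant of the matrix in which row \<open>u\<close> and column \<open>v\<close> are both cleared except for
  their common entry. That matrix is compatible with transposition.
\<close>

lemma cofactor_on_transpose:
  assumes "finite V" "u \<in> V" "v \<in> V"
  shows "cofactor_on V (\<lambda>x y. f y x) v u = cofactor_on V f u v"
proof -
  let ?cross = "\<lambda>f a b x y. if x = a \<or> y = b then of_bool (x = a \<and> y = b) else f x y"
  have eq: "cofactor_on V f a b = det_on V (?cross f a b)" if "a \<in> V" for a b f
    unfolding cofactor_on_def det_on_def
  proof (rule sum.cong[OF refl])
    fix p assume "p \<in> {p. p permutes V}"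
    hence inj: "p x = p a \<longleftrightarrow> x = a" for x by (metis mem_Collect_eq permutes_inj injD)
    have "(\<Prod>x\<in>V. (f(a := unit_row b)) x (p x)) = (\<Prod>x\<in>V. ?cross f a b x (p x))"
    proof (cases "p a = b")
      case True
      show ?thesis
        by (rule prod.cong) (use True inj in \<open>auto simp: unit_row_def\<close>)
    next
      case False
      have "(\<Prod>x\<in>V. (f(a := unit_row b)) x (p x)) = 0"
        by (rule prod_zero[OF assms(1)])
          (rule bexI[OF _ that], use False in \<open>simp add: unit_row_def\<close>)
      moreover have "(\<Prod>x\<in>V. ?cross f a b x (p x)) = 0"
        by (rule prod_zero[OF assms(1)]) (rule bexI[OF _ that], use False in simp)
      ultimately show ?thesis by simp
    qed
    thus "of_int (sign p) * (\<Prod>x\<in>V. (f(a := unit_row b)) x (p x))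
        = of_int (sign p) * (\<Prod>x\<in>V. ?cross f a b x (p x))" by simp
  qed
  have "?cross (\<lambda>x y. f y x) v u = (\<lambda>x y. ?cross f u v y x)" by (auto simp: fun_eq_iff)
  hence "cofactor_on V (\<lambda>x y. f y x) v u = det_on V (\<lambda>x y. ?cross f u v y x)"
    using eq[OF assms(3), of "\<lambda>x y. f y x" u] by (simp only:)
  also have "\<dots> = det_on V (?cross f u v)" by (rule det_on_transpose[OF assms(1)])
  also have "\<dots> = cofactor_on V f u v" by (rule eq[OF assms(2), symmetric])
  finally show ?thesis .
qed

lemma det_on_delete_unit_rows:
  assumes "finite V" "W \<subseteq> V" "\<And>x y. x \<in> V - W \<Longrightarrow> y \<in> V \<Longrightarrow> f x y = unit_row x y"
  shows "det_on V f = det_on W f"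
proof -
  have "det_on (W \<union> D) f = det_on W f" if "finite D" "D \<subseteq> V - W" for D
    using that
  proof (induction D rule: finite_induct)
    case (insert d D)
    let ?U = "W \<union> insert d D"
    have U: "finite ?U" "d \<in> ?U" "?U \<subseteq> V"
      using insert.prems insert.hyps assms(1,2) by (auto intro: finite_subset)
    have "det_on ?U f = cofactor_on ?U f d d"
      unfolding cofactor_on_def
      by (rule det_on_cong) (use insert.prems U(3) assms(3) in auto)
    also have "\<dots> = det_on (?U - {d}) f" by (rule cofactor_on_diag[OF U(1,2)])
    also have "?U - {d} = W \<union> D" using insert by auto
    finally show ?case using insert by simp
  qed simp
  from this[of "V - W"] assms show ?thesis by (simp add: Un_absorb1)
qed

text \<open>
  This is Laplace expansion along two rows when only one \<open>2 \<times> 2\<close> minor of these rows can be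
  nonzero. By bilinearity it reduces to unit rows: equal unit rows give zero, the rows in their
  natural places leave the complementary minor, and the interchanged rows differ from it by a sign.
\<close>

lemma det_on_two_sparse_rows:
  assumes V: "finite V" "u \<in> V" "v \<in> V" "u \<noteq> v"
    and g: "\<And>y. y \<in> V - {u, v} \<Longrightarrow> g y = 0" and h: "\<And>y. y \<in> V - {u, v} \<Longrightarrow> h y = 0"
  shows "det_on V (f(u := g, v := h)) = (g u * h v - g v * h u) * det_on (V - {u, v}) f"
proof -
  let ?E = "\<lambda>a b. det_on V (f(u := unit_row a, v := unit_row b))"
  have expand: "det_on V (f(u := g, v := h)) =
      h u * (g u * ?E u u + g v * ?E v u) + h v * (g u * ?E u v + g v * ?E v v)"
    if g: "\<And>y. y \<in> V - {u, v} \<Longrightarrow> g y = 0" and h: "\<And>y. y \<in> V - {u, v} \<Longrightarrow> h y = 0" for g h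
  proof -
    have 1: "det_on V (f(u := g, v := unit_row b)) = g u * ?E u b + g v * ?E v b" for b
    proof -
      have "det_on V (f(v := unit_row b, u := g)) =
          g u * cofactor_on V (f(v := unit_row b)) u u + g v * cofactor_on V (f(v := unit_row b)) u v"
        by (rule det_on_expand_sparse_row[OF V]) (use g V(2) in auto)
      thus ?thesis by (simp only: cofactor_on_def fun_upd_twist[OF V(4)])
    qed
    have "det_on V (f(u := g, v := h)) =
        h u * cofactor_on V (f(u := g)) v u + h v * cofactor_on V (f(u := g)) v v"
      by (rule det_on_expand_sparse_row[OF V]) (use h V(3) in auto)
    thus ?thesis by (simp only: cofactor_on_def 1)
  qed
  have same: "?E a a = 0" for a
    by (rule det_on_identical_rows[OF V]) (use V(4) in simp)
  have id: "?E u v = det_on (V - {u, v}) f"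
  proof -
    have "?E u v = cofactor_on V (f(u := unit_row u)) v v" by (simp add: cofactor_on_def)
    also have "\<dots> = cofactor_on (V - {v}) f u u"
      using V by (subst cofactor_on_diag) (auto simp: cofactor_on_def)
    also have "\<dots> = det_on (V - {v} - {u}) f" using V by (subst cofactor_on_diag) auto
    also have "V - {v} - {u} = V - {u, v}" by auto
    finally show ?thesis .
  qed
  have "?E v u = - ?E u v"
  proof -
    \<comment> \<open>Polarization: a vanishing determinant with the same row in both places is expanded.\<close>
    let ?s = "\<lambda>y. unit_row u y + unit_row v y"
    have "det_on V (f(u := ?s, v := ?s)) = 0"
      by (rule det_on_identical_rows[OF V]) (use V(4) in simp)
    thus ?thesis
      using expand[of ?s ?s] V(4) by (auto simp: unit_row_def same add_eq_0_iff)
  qed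
  moreover have "det_on V (f(u := g, v := h)) =
      h u * (g u * ?E u u + g v * ?E v u) + h v * (g u * ?E u v + g v * ?E v v)"
    by (rule expand) (use g h in auto)
  ultimately show ?thesis by (simp add: same id algebra_simps)
qed

lemma det_on_perturb_two_rows:
  assumes V: "finite V" "u \<in> V" "v \<in> V" "u \<noteq> v"
    and g: "\<And>y. y \<in> V - {u, v} \<Longrightarrow> g y = 0" and h: "\<And>y. y \<in> V - {u, v} \<Longrightarrow> h y = 0"
  shows "det_on V (f(u := \<lambda>y. f u y + g y, v := \<lambda>y. f v y + h y)) =
    det_on V f + (g u * cofactor_on V f u u + g v * cofactor_on V f u v)
      + (h u * cofactor_on V f v u + h v * cofactor_on V f v v)
      + (g u * h v - g v * h u) * det_on (V - {u, v}) f"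
proof -
  let ?fu = "\<lambda>y. f u y + g y"
  have row_u: "det_on V (f(u := g)) = g u * cofactor_on V f u u + g v * cofactor_on V f u v"
    by (rule det_on_expand_sparse_row[OF V]) (use g V in auto)
  have row_v: "det_on V (f(v := h)) = h u * cofactor_on V f v u + h v * cofactor_on V f v v"
    by (rule det_on_expand_sparse_row[OF V]) (use h V in auto)
  have rows_uv: "det_on V (f(u := g, v := h)) = (g u * h v - g v * h u) * det_on (V - {u, v}) f"
    by (rule det_on_two_sparse_rows[OF V]) (use g h in auto)
  have "det_on V (f(u := ?fu, v := \<lambda>y. f v y + h y)) =
      det_on V (f(u := ?fu)) + det_on V (f(v := h, u := ?fu))"
    using det_on_add_row[OF V(1,3), of "f(u := ?fu)" "f v" h] V(4)
    by (simp add: fun_upd_twist[OF V(4)] fun_upd_idem)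
  also have "det_on V (f(u := ?fu)) = det_on V f + det_on V (f(u := g))"
    using det_on_add_row[OF V(1,2), of f "f u" g] by simp
  also have "det_on V (f(v := h, u := ?fu)) = det_on V (f(v := h)) + det_on V (f(u := g, v := h))"
    using det_on_add_row[OF V(1,2), of "f(v := h)" "f u" g] V(4)
    by (simp add: fun_upd_twist[OF V(4)] fun_upd_idem)
  also have "det_on V f + det_on V (f(u := g)) + (det_on V (f(v := h)) + det_on V (f(u := g, v := h))) =
      det_on V f + det_on V (f(u := g)) + det_on V (f(v := h)) + det_on V (f(u := g, v := h))"
    by (simp only: add.assoc)
  finally show ?thesis unfolding row_u row_v rows_uv .
qed

text \<open>
  Replacing rows \<open>u\<close> and \<open>v\<close> of the identity matrix by rows of cofactors gives a matrix \<open>N\<close> whose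
  determinant is the right-hand side. Its product with the transpose of \<open>f\<close> is the transpose of \<open>f\<close>
  with rows \<open>u\<close> and \<open>v\<close> replaced by multiples of unit rows, whose determinant is
  \<open>(det f)\<^sup>2\<close> times the complementary minor. One factor \<open>det f\<close> cancels.
\<close>

lemma jacobi_complementary_minor:
  fixes f :: "'a \<Rightarrow> 'a \<Rightarrow> 'r :: idom"
  assumes V: "finite V" "u \<in> V" "v \<in> V" "u \<noteq> v" and nz: "det_on V f \<noteq> 0"
  shows "det_on V f * det_on (V - {u, v}) f =
    cofactor_on V f u u * cofactor_on V f v v - cofactor_on V f u v * cofactor_on V f v u"
proof -
  let ?d = "det_on V f"
  let ?c = "cofactor_on V f"
  define N where "N x y = (if x = u \<or> x = v then ?c x y else unit_row x y)" for x y
  define P where "P x y = (\<Sum>k\<in>V. N x k * f y k)" for x y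
  have adj: "(\<Sum>k\<in>V. ?c x k * f y k) = ?d * unit_row x y" if "x \<in> V" "y \<in> V" for x y
  proof -
    \<comment> \<open>The sum is the expansion of the determinant in which row \<open>x\<close> is a copy of row \<open>y\<close>.\<close>
    have "(\<Sum>k\<in>V. ?c x k * f y k) = det_on V (f(x := f y))"
      using det_on_expand_row[OF V(1) that(1), of f "f y"] by (simp add: mult.commute)
    also have "\<dots> = ?d * unit_row x y"
    proof (cases "y = x")
      case False
      thus ?thesis using det_on_identical_rows[OF V(1) that(1,2), of "f(x := f y)"]
        by (simp add: unit_row_def)
    qed (simp add: unit_row_def)
    finally show ?thesis .
  qed
  have "det_on V N = det_on {u, v} N"
    by (rule det_on_delete_unit_rows) (use V in \<open>auto simp: N_def\<close>)
  also have "\<dots> = ?c u u * ?c v v - ?c u v * ?c v u"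
    using det_on_two_sparse_rows[of "{u, v}" u v "N u" "N v" N] V(4) by (simp add: N_def)
  finally have N: "det_on V N = ?c u u * ?c v v - ?c u v * ?c v u" .
  have "det_on V P = det_on V N * det_on V (\<lambda>k y. f y k)"
    unfolding P_def using det_on_mult[OF V(1), of N "\<lambda>k y. f y k"] .
  hence 1: "det_on V P = det_on V N * ?d" by (simp only: det_on_transpose[OF V(1), of f])
  have "det_on V P = det_on V ((\<lambda>x y. f y x)(u := \<lambda>y. ?d * unit_row u y, v := \<lambda>y. ?d * unit_row v y))"
  proof (rule det_on_cong)
    fix x y assume xy: "x \<in> V" "y \<in> V"
    have "V \<inter> {k. k = x} = {x}" using xy by auto
    hence "(\<Sum>k\<in>V. unit_row x k * f y k) = f y x"
      using V(1) by (simp add: unit_row_def)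
    thus "P x y = ((\<lambda>x y. f y x)(u := \<lambda>y. ?d * unit_row u y, v := \<lambda>y. ?d * unit_row v y)) x y"
      using adj xy unfolding P_def N_def by auto
  qed
  also have "\<dots> = ?d * ?d * det_on (V - {u, v}) (\<lambda>x y. f y x)"
    using V(4) by (subst det_on_two_sparse_rows[OF V]) (auto simp: unit_row_def)
  also have "\<dots> = ?d * (?d * det_on (V - {u, v}) f)"
    using V(1) by (simp add: det_on_transpose[of "V - {u, v}" f] mult.assoc)
  finally show ?thesis using 1 N nz by (simp add: mult.commute[of ?d])
qed

section \<open>Characteristic polynomials of weighted graphs\<close>

definition char_entry :: "'a wgraph \<Rightarrow> 'a \<Rightarrow> 'a \<Rightarrow> real poly" where
  "char_entry X x y = [:0, 1:] * of_bool (x = y) + [:- weight X x y:]"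

lemma char_poly_matrix_adj_matrix:
  assumes "weighted_graph X"
  shows "char_poly_matrix (adj_matrix X) = mat (card (verts X)) (card (verts X))
    (\<lambda>(i, j). char_entry X (vertex_enum X i) (vertex_enum X j))"
  using vertex_enum_bij[OF assms]
  by (intro eq_matI) (auto simp: char_poly_matrix_def adj_matrix_def char_entry_def bij_betw_def inj_on_eq_iff)

lemma graph_char_poly_eq_det_on:
  assumes "weighted_graph X"
  shows "graph_char_poly X = det_on (verts X) (char_entry X)"
  unfolding graph_char_poly_def char_poly_def char_poly_matrix_adj_matrix[OF assms]
  by (rule det_on_eq_det_mat[OF vertex_enum_bij[OF assms], symmetric])

lemma graph_char_poly_delete_verts:
  assumes "weighted_graph X"
  shows "graph_char_poly (delete_verts X S) = det_on (verts X - S) (char_entry X)"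
proof -
  have "char_entry (delete_verts X S) = char_entry X"
    by (simp add: fun_eq_iff char_entry_def delete_verts_def)
  thus ?thesis
    unfolding graph_char_poly_eq_det_on[OF weighted_graph_delete_verts[OF assms]]
    by (simp add: delete_verts_def)
qed

lemma cofactor_eq_det_unit_row:
  assumes A: "A \<in> carrier_mat n n" and ij: "i < n" "j < n"
  shows "cofactor A i j = det (mat n n (\<lambda>(a, b). if a = i then of_bool (b = j) else A $$ (a, b)))"
proof -
  let ?B = "mat n n (\<lambda>(a, b). if a = i then of_bool (b = j) else A $$ (a, b))"
  have "det ?B = (\<Sum>k<n. of_bool (k = j) * cofactor ?B i k)"
    using ij by (subst laplace_expansion_row[of _ n i]) auto
  also have "\<dots> = cofactor ?B i j"
  proof -
    have "{..<n} \<inter> {k. k = j} = {j}" using ij by auto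
    thus ?thesis by simp
  qed
  also have "mat_delete ?B i j = mat_delete A i j"
    using A ij by (intro eq_matI) (auto simp: mat_delete_def)
  hence "cofactor ?B i j = cofactor A i j" by (simp add: cofactor_def)
  finally show ?thesis ..
qed

text \<open>The order of the vertices is reversed because the adjugate is the transposed cofactor matrix.\<close>

lemma cross_poly_eq_cofactor_on:
  assumes X: "weighted_graph X" and uv: "u \<in> verts X" "v \<in> verts X"
  shows "cross_poly X u v = cofactor_on (verts X) (char_entry X) v u"
proof -
  let ?n = "card (verts X)"
  let ?e = "vertex_enum X"
  let ?C = "char_poly_matrix (adj_matrix X)"
  note e = vertex_enum_bij[OF X]
  define i where "i = vertex_index X u"
  define j where "j = vertex_index X v"
  have ij: "i < ?n" "j < ?n" "?e i = u" "?e j = v"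
    using vertex_index_less[OF X] uv bij_betw_inv_into_right[OF e]
    by (auto simp: i_def j_def vertex_index_def)
  have C: "?C \<in> carrier_mat ?n ?n" using char_poly_matrix_closed[OF adj_matrix_carrier] .
  have "cross_poly X u v = cofactor ?C j i"
    unfolding cross_poly_eq_adjugate[OF assms] i_def[symmetric] j_def[symmetric]
    using C ij by (simp add: adj_mat_def)
  also have "\<dots> = det (mat ?n ?n (\<lambda>(a, b). if a = j then of_bool (b = i) else ?C $$ (a, b)))"
    by (rule cofactor_eq_det_unit_row[OF C ij(2,1)])
  also have "mat ?n ?n (\<lambda>(a, b). if a = j then of_bool (b = i) else ?C $$ (a, b))
      = mat ?n ?n (\<lambda>(a, b). ((char_entry X)(v := unit_row u)) (?e a) (?e b))"
  proof (rule eq_matI)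
    fix a b assume "a < dim_row (mat ?n ?n (\<lambda>(a, b). ((char_entry X)(v := unit_row u)) (?e a) (?e b)))"
      "b < dim_col (mat ?n ?n (\<lambda>(a, b). ((char_entry X)(v := unit_row u)) (?e a) (?e b)))"
    hence ab: "a < ?n" "b < ?n" by auto
    have "?e a = v \<longleftrightarrow> a = j" "?e b = u \<longleftrightarrow> b = i"
      using e ab ij by (auto simp: bij_betw_def inj_on_def)
    thus "mat ?n ?n (\<lambda>(a, b). if a = j then of_bool (b = i) else ?C $$ (a, b)) $$ (a, b)
      = mat ?n ?n (\<lambda>(a, b). ((char_entry X)(v := unit_row u)) (?e a) (?e b)) $$ (a, b)"
      using ab by (simp add: char_poly_matrix_adj_matrix[OF X] unit_row_def)
  qed auto
  also have "det \<dots> = cofactor_on (verts X) (char_entry X) v u"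
    unfolding cofactor_on_def by (rule det_on_eq_det_mat[OF e, symmetric])
  finally show ?thesis .
qed

lemma cross_poly_commute:
  assumes X: "weighted_graph X" and uv: "u \<in> verts X" "v \<in> verts X"
  shows "cross_poly X u v = cross_poly X v u"
proof -
  let ?V = "verts X"
  have fin: "finite ?V" using X by (simp add: weighted_graph_def)
  have "cofactor_on ?V (char_entry X) v u = cofactor_on ?V (\<lambda>x y. char_entry X y x) v u"
    unfolding cofactor_on_def
    by (rule det_on_cong) (use X in \<open>auto simp: char_entry_def weighted_graph_def\<close>)
  also have "\<dots> = cofactor_on ?V (char_entry X) u v"
    by (rule cofactor_on_transpose[OF fin uv])
  finally show ?thesis using assms by (simp add: cross_poly_eq_cofactor_on)
qed

lemma graph_char_poly_perturb:
  assumes X: "weighted_graph X" and uv: "u \<in> verts X" "v \<in> verts X" "u \<noteq> v"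
  shows "graph_char_poly (perturb X u v \<beta> \<gamma>) =
      graph_char_poly X
      - Polynomial.smult (2 * \<beta>) (cross_poly X u v)
      - Polynomial.smult \<gamma> (graph_char_poly (delete_verts X {v}) + graph_char_poly (delete_verts X {u}))
      + Polynomial.smult (\<gamma>\<^sup>2 - \<beta>\<^sup>2) (graph_char_poly (delete_verts X {u, v}))"
proof -
  let ?V = "verts X"
  let ?f = "char_entry X"
  let ?c = "cofactor_on ?V ?f"
  have V: "finite ?V" using X by (simp add: weighted_graph_def)
  define g :: "'a \<Rightarrow> real poly" where "g y = [:- \<gamma> * of_bool (y = u) - \<beta> * of_bool (y = v):]" for y
  define h :: "'a \<Rightarrow> real poly" where "h y = [:- \<gamma> * of_bool (y = v) - \<beta> * of_bool (y = u):]" for y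
  have entry: "char_entry (perturb X u v \<beta> \<gamma>) = ?f(u := \<lambda>y. ?f u y + g y, v := \<lambda>y. ?f v y + h y)"
    using uv(3) by (auto simp: fun_eq_iff char_entry_def perturb_def g_def h_def)
  have gh: "g u = [:- \<gamma>:]" "g v = [:- \<beta>:]" "h u = [:- \<beta>:]" "h v = [:- \<gamma>:]"
    using uv(3) by (auto simp: g_def h_def)
  have "graph_char_poly (perturb X u v \<beta> \<gamma>) =
      det_on ?V (?f(u := \<lambda>y. ?f u y + g y, v := \<lambda>y. ?f v y + h y))"
    unfolding graph_char_poly_eq_det_on[OF weighted_graph_perturb[OF X]] entry
    by (simp add: perturb_def)
  also have "\<dots> = det_on ?V ?f + (g u * ?c u u + g v * ?c u v) + (h u * ?c v u + h v * ?c v v)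
      + (g u * h v - g v * h u) * det_on (?V - {u, v}) ?f"
    by (rule det_on_perturb_two_rows[OF V uv]) (auto simp: g_def h_def)
  finally have pert: "graph_char_poly (perturb X u v \<beta> \<gamma>) =
      det_on ?V ?f + (g u * ?c u u + g v * ?c u v) + (h u * ?c v u + h v * ?c v v)
      + (g u * h v - g v * h u) * det_on (?V - {u, v}) ?f" .
  have cross: "?c u v = cross_poly X u v" "?c v u = cross_poly X u v"
    using cross_poly_commute[OF X uv(1,2)] cross_poly_eq_cofactor_on[OF X] uv by auto
  have diag: "?c u u = graph_char_poly (delete_verts X {u})" "?c v v = graph_char_poly (delete_verts X {v})"
    by (simp_all add: graph_char_poly_delete_verts[OF X] cofactor_on_diag[OF V] uv)
  have del: "det_on (?V - {u, v}) ?f = graph_char_poly (delete_verts X {u, v})"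
    by (simp add: graph_char_poly_delete_verts[OF X])
  have "det_on ?V ?f = graph_char_poly X"
    by (simp add: graph_char_poly_eq_det_on[OF X])
  moreover have "Polynomial.smult (2 * \<beta>) (cross_poly X u v) =
      Polynomial.smult \<beta> (cross_poly X u v) + Polynomial.smult \<beta> (cross_poly X u v)"
    by (simp flip: smult_add_left)
  ultimately show ?thesis
    unfolding pert gh cross diag del
    by (simp add: power2_eq_square smult_add_right)
qed

lemma graph_char_poly_delete_two_verts:
  assumes X: "weighted_graph X" and uv: "u \<in> verts X" "v \<in> verts X" "u \<noteq> v"
  shows "graph_char_poly X * graph_char_poly (delete_verts X {u, v}) =
    graph_char_poly (delete_verts X {u}) * graph_char_poly (delete_verts X {v}) - (cross_poly X u v)\<^sup>2"
proof -
  have V: "finite (verts X)" using X by (simp add: weighted_graph_def)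
  have "cofactor_on (verts X) (char_entry X) u v = cross_poly X u v"
    "cofactor_on (verts X) (char_entry X) v u = cross_poly X u v"
    using cross_poly_commute[OF X uv(1,2)] cross_poly_eq_cofactor_on[OF X] uv by auto
  thus ?thesis
    using jacobi_complementary_minor[OF V uv, of "char_entry X"] graph_char_poly_nonzero[of X]
    by (simp add: graph_char_poly_eq_det_on[OF X] graph_char_poly_delete_verts[OF X]
        cofactor_on_diag[OF V] uv power2_eq_square)
qed

theorem theorem4:
  fixes X :: "'a wgraph" and u v :: 'a and \<beta> \<gamma> :: real
  assumes "weighted_graph X"
    and "u \<in> verts X" and "v \<in> verts X" and "u \<noteq> v"
  shows "graph_char_poly (perturb X u v \<beta> \<gamma>) =
      graph_char_poly X
      - Polynomial.smult (2 * \<beta>) (cross_poly X u v)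
      - Polynomial.smult \<gamma> (graph_char_poly (delete_verts X {v}) + graph_char_poly (delete_verts X {u}))
      + Polynomial.smult (\<gamma>\<^sup>2 - \<beta>\<^sup>2) (graph_char_poly (delete_verts X {u, v}))
    \<and> (cospectral_verts X u v \<longrightarrow>
      to_fract (graph_char_poly (perturb X u v \<beta> \<gamma>)) / to_fract (graph_char_poly X) =
        (1 - to_fract (Polynomial.smult (\<beta> - \<gamma>) (cross_poly X u v - graph_char_poly (delete_verts X {u})))
               / to_fract (graph_char_poly X))
      * (1 - to_fract (Polynomial.smult (\<beta> + \<gamma>) (cross_poly X u v + graph_char_poly (delete_verts X {u})))
               / to_fract (graph_char_poly X)))"
proof (intro conjI impI)
  let ?pert = "graph_char_poly (perturb X u v \<beta> \<gamma>)"
  let ?\<phi> = "graph_char_poly X"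
  let ?\<phi>u = "graph_char_poly (delete_verts X {u})"
  let ?\<phi>v = "graph_char_poly (delete_verts X {v})"
  let ?\<phi>uv = "cross_poly X u v"
  let ?del = "graph_char_poly (delete_verts X {u, v})"
  show expansion: "?pert = ?\<phi> - Polynomial.smult (2 * \<beta>) ?\<phi>uv - Polynomial.smult \<gamma> (?\<phi>v + ?\<phi>u)
      + Polynomial.smult (\<gamma>\<^sup>2 - \<beta>\<^sup>2) ?del"
    by (rule graph_char_poly_perturb[OF assms])
  assume "cospectral_verts X u v"
  hence cosp: "?\<phi>v = ?\<phi>u" by (simp add: cospectral_verts_def)
  let ?a = "[:\<beta> - \<gamma>:] * (?\<phi>uv - ?\<phi>u)"
  let ?b = "[:\<beta> + \<gamma>:] * (?\<phi>uv + ?\<phi>u)"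
  have jacobi: "?\<phi> * ?del = ?\<phi>u * ?\<phi>u - ?\<phi>uv * ?\<phi>uv"
    using graph_char_poly_delete_two_verts[OF assms] by (simp add: cosp power2_eq_square)
  have pert: "?pert = ?\<phi> - [:2 * \<beta>:] * ?\<phi>uv - [:\<gamma>:] * (?\<phi>u + ?\<phi>u) + [:\<gamma>\<^sup>2 - \<beta>\<^sup>2:] * ?del"
    unfolding expansion cosp by simp
  \<comment> \<open>The scalars are kept as constant polynomials, so that ring normalization sees only products
    of \<open>[:\<beta>:]\<close> and \<open>[:\<gamma>:]\<close>.\<close>
  have split_coeffs: "[:2 * \<beta>:] = [:\<beta>:] + [:\<beta>:]" "[:\<gamma>\<^sup>2 - \<beta>\<^sup>2:] = [:\<gamma>:] * [:\<gamma>:] - [:\<beta>:] * [:\<beta>:]"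
    "[:\<beta> - \<gamma>:] = [:\<beta>:] - [:\<gamma>:]" "[:\<beta> + \<gamma>:] = [:\<beta>:] + [:\<gamma>:]"
    by (simp_all add: power2_eq_square)
  \<comment> \<open>Multiplying by \<open>\<phi>(X)\<close> brings the last summand into the form to which Jacobi's identity applies.\<close>
  have "?pert * ?\<phi> = ?\<phi> * ?\<phi> - [:2 * \<beta>:] * ?\<phi>uv * ?\<phi> - [:\<gamma>:] * (?\<phi>u + ?\<phi>u) * ?\<phi>
      + [:\<gamma>\<^sup>2 - \<beta>\<^sup>2:] * (?\<phi> * ?del)"
    unfolding pert by (simp only: algebra_simps)
  also have "\<dots> = (?\<phi> - ?a) * (?\<phi> - ?b)"
    unfolding jacobi split_coeffs by (simp only: algebra_simps)
  finally have "?pert * ?\<phi> = (?\<phi> - ?a) * (?\<phi> - ?b)" .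
  hence "to_fract ?pert * to_fract ?\<phi> =
      (to_fract ?\<phi> - to_fract ?a) * (to_fract ?\<phi> - to_fract ?b)"
    by (metis to_fract_hom.hom_mult to_fract_hom.hom_minus)
  moreover have "to_fract ?\<phi> \<noteq> 0" using graph_char_poly_nonzero by simp
  ultimately have "to_fract ?pert / to_fract ?\<phi> =
      (1 - to_fract ?a / to_fract ?\<phi>) * (1 - to_fract ?b / to_fract ?\<phi>)"
    by (simp add: field_simps)
  thus "to_fract ?pert / to_fract ?\<phi> =
        (1 - to_fract (Polynomial.smult (\<beta> - \<gamma>) (?\<phi>uv - ?\<phi>u)) / to_fract ?\<phi>)
      * (1 - to_fract (Polynomial.smult (\<beta> + \<gamma>) (?\<phi>uv + ?\<phi>u)) / to_fract ?\<phi>)"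
    by simp
qed

end
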